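(* Consider a Gaussian two-way relay channel with power $P>0$ and real channel gains $g_{12},g_{1r},g_{21},g_{2r},g_{r1},g_{r2}$, where $g_{1r}\neq 0$ and $g_{2r}\neq 0$ so that the following quotients are defined: $$\sigma_{c1}^2=\frac{1+g_{21}^2P}{g_{2r}^2P},\quad \sigma_{c2}^2=\frac{1+g_{12}^2P}{g_{1r}^2P},\quad \sigma_{e1}^2=\frac{1+g_{21}^2P+g_{r1}^2P}{g_{2r}^2P},\quad \sigma_{e2}^2=\frac{1+g_{12}^2P+g_{r2}^2P}{g_{1r}^2P}.$$ Let $\mathcal{R}_{\mathrm{NB}}$ be the rate region of compress-forward without binning and $\mathcal{R}_{\mathrm{NNC}}$ the rate region of noisy network coding for this channel, as given by the explicit formulas in the context. If $$\sigma_{c1}^2\leq\sigma_{e2}^2\quad\text{and}\quad \sigma_{c2}^2\leq\sigma_{e1}^2,$$ then compress-forward without binning achieves the same rate region as noisy network coding, $\mathcal{R}_{\mathrm{NB}}=\mathcal{R}_{\mathrm{NNC}}$. Otherwise, compress-forward without binning achieves a smaller rate region: $\mathcal{R}_{\mathrm{NB}}\subsetneq\mathcal{R}_{\mathrm{NNC}}$.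
   Context: The Gaussian two-way relay channel is $Y_1=g_{12}X_2+g_{1r}X_r+Z_1$, $Y_2=g_{21}X_1+g_{2r}X_r+Z_2$, $Y_r=g_{r1}X_1+g_{r2}X_2+Z_r$, with independent noises $Z_1,Z_2,Z_r\sim\mathcal{N}(0,1)$ and average power constraint $P$ on each of the inputs $X_1$ (user 1), $X_2$ (user 2) and $X_r$ (relay). Let $C(x)=\tfrac12\log_2(1+x)$, and for $\sigma^2>0$ put $$R_{11}(\sigma^2)=C\Big(g_{21}^2P+\frac{g_{r1}^2P}{1+\sigma^2}\Big),\qquad R_{12}(\sigma^2)=C(g_{21}^2P+g_{2r}^2P)-C(1/\sigma^2),$$ $$R_{21}(\sigma^2)=C\Big(g_{12}^2P+\frac{g_{r2}^2P}{1+\sigma^2}\Big),\qquad R_{22}(\sigma^2)=C(g_{12}^2P+g_{1r}^2P)-C(1/\sigma^2).$$ The noisy network coding region $\mathcal{R}_{\mathrm{NNC}}$ is the set of pairs $(R_1,R_2)$ with $R_1,R_2\ge0$ such that, for some $\sigma^2>0$, $$R_1\le\min\{R_{11}(\sigma^2),R_{12}(\sigma^2)\},\qquad R_2\le\min\{R_{21}(\sigma^2),R_{22}(\sigma^2)\}.$$ The region of compress-forward without binning, $\mathcal{R}_{\mathrm{NB}}$, is the set of pairs $(R_1,R_2)$ with $R_1,R_2\ge0$ satisfying the same two inequalities for some $\sigma^2\ge\max\{\sigma_{c1}^2,\sigma_{c2}^2\}$.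
   Formalization: When the condition fails, strict inclusion is claimed exactly if g21,gr2≠0 whenever σ_c1²>σ_e2², and g12,gr1≠0 whenever σ_c2²>σ_e1²; in the remaining cases the regions are equal, so the literal claim is false there (e.g. P=1, g12=g21=0, g1r=2, other gains 1). *)

theory Defs
  imports Complex_Main
begin

text \<open>
  \<open>g_ij\<close> is the gain from node \<open>j\<close> to node \<open>i\<close>; \<open>pow_constr\<close> is the common power constraint.
  All noise variances are 1. The gains are arbitrary reals, possibly 0.
\<close>

record relay_channel =
  pow_constr :: real
  g_12 :: real
  g_1r :: real
  g_21 :: real
  g_2r :: real
  g_r1 :: real
  g_r2 :: real

definition C :: "real \<Rightarrow> real" where
  "C x = 1 / 2 * log 2 (1 + x)"

text \<open>Throughout, the argument \<open>s\<close> stands for the quantization noise variance \<open>\<sigma>\<^sup>2\<close> itself.\<close>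

definition R11 :: "relay_channel \<Rightarrow> real \<Rightarrow> real" where
  "R11 ch s = C ((g_21 ch)\<^sup>2 * pow_constr ch + (g_r1 ch)\<^sup>2 * pow_constr ch / (1 + s))"

definition R12 :: "relay_channel \<Rightarrow> real \<Rightarrow> real" where
  "R12 ch s = C ((g_21 ch)\<^sup>2 * pow_constr ch + (g_2r ch)\<^sup>2 * pow_constr ch) - C (1 / s)"

definition R21 :: "relay_channel \<Rightarrow> real \<Rightarrow> real" where
  "R21 ch s = C ((g_12 ch)\<^sup>2 * pow_constr ch + (g_r2 ch)\<^sup>2 * pow_constr ch / (1 + s))"

definition R22 :: "relay_channel \<Rightarrow> real \<Rightarrow> real" where
  "R22 ch s = C ((g_12 ch)\<^sup>2 * pow_constr ch + (g_1r ch)\<^sup>2 * pow_constr ch) - C (1 / s)"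

definition sq_sigma_c1 :: "relay_channel \<Rightarrow> real" where
  "sq_sigma_c1 ch = (1 + (g_21 ch)\<^sup>2 * pow_constr ch) / ((g_2r ch)\<^sup>2 * pow_constr ch)"

definition sq_sigma_c2 :: "relay_channel \<Rightarrow> real" where
  "sq_sigma_c2 ch = (1 + (g_12 ch)\<^sup>2 * pow_constr ch) / ((g_1r ch)\<^sup>2 * pow_constr ch)"

definition sq_sigma_e1 :: "relay_channel \<Rightarrow> real" where
  "sq_sigma_e1 ch = (1 + (g_21 ch)\<^sup>2 * pow_constr ch + (g_r1 ch)\<^sup>2 * pow_constr ch)
     / ((g_2r ch)\<^sup>2 * pow_constr ch)"

definition sq_sigma_e2 :: "relay_channel \<Rightarrow> real" where
  "sq_sigma_e2 ch = (1 + (g_12 ch)\<^sup>2 * pow_constr ch + (g_r2 ch)\<^sup>2 * pow_constr ch)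
     / ((g_1r ch)\<^sup>2 * pow_constr ch)"

definition R_NNC :: "relay_channel \<Rightarrow> (real \<times> real) set" where
  "R_NNC ch = {(R1, R2). 0 \<le> R1 \<and> 0 \<le> R2 \<and>
     (\<exists>s>0. R1 \<le> min (R11 ch s) (R12 ch s) \<and> R2 \<le> min (R21 ch s) (R22 ch s))}"

text \<open>
  For positive power and nonzero \<open>g_1r\<close>, \<open>g_2r\<close> both lower bounds are positive, so
  \<open>s > 0\<close> is implied here.
\<close>

definition R_NB :: "relay_channel \<Rightarrow> (real \<times> real) set" where
  "R_NB ch = {(R1, R2). 0 \<le> R1 \<and> 0 \<le> R2 \<and>
     (\<exists>s\<ge>max (sq_sigma_c1 ch) (sq_sigma_c2 ch).
        R1 \<le> min (R11 ch s) (R12 ch s) \<and> R2 \<le> min (R21 ch s) (R22 ch s))}"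

text \<open>
  If the condition for equality of the regions fails, strict inclusion needs the gains named
  here. When \<open>sq_sigma_c1 > sq_sigma_e2\<close>, parameters \<open>s < sq_sigma_c1\<close> force \<open>R12 < 0\<close> if
  \<open>g_21 = 0\<close>, hence contribute no pair of nonnegative rates, and \<open>R21\<close> does not depend on \<open>s\<close>
  if \<open>g_r2 = 0\<close>; either way the two regions coincide. For example power 1,
  \<open>g_12 = g_21 = 0\<close>, \<open>g_1r = 2\<close>, \<open>g_2r = g_r1 = g_r2 = 1\<close> has
  \<open>sq_sigma_c1 = 1 > 1/2 = sq_sigma_e2\<close> but equal regions. Symmetrically for the other user.
  Nonzero \<open>g_12\<close>, \<open>g_21\<close>, \<open>g_r1\<close>, \<open>g_r2\<close> always suffice.
\<close>

definition nondegenerate :: "relay_channel \<Rightarrow> bool" where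
  "nondegenerate ch \<longleftrightarrow>
     (sq_sigma_c1 ch > sq_sigma_e2 ch \<longrightarrow> g_21 ch \<noteq> 0 \<and> g_r2 ch \<noteq> 0) \<and>
     (sq_sigma_c2 ch > sq_sigma_e1 ch \<longrightarrow> g_12 ch \<noteq> 0 \<and> g_r1 ch \<noteq> 0)"

end

theory Submission
  imports Defs
begin

text \<open>
  \<open>R12\<close> increases and \<open>R11\<close> decreases in \<open>s\<close>, and they cross at \<open>sq_sigma_e1\<close>; likewise for user 2
  with \<open>sq_sigma_e2\<close>. Put \<open>m = max sq_sigma_c1 sq_sigma_c2\<close>. If \<open>m\<close> is at most both crossing points,
  then raising any \<open>s < m\<close> to \<open>m\<close> increases both minima, so the regions agree. The two conditions
  cannot fail simultaneously, so by symmetry let \<open>sq_sigma_e2 < sq_sigma_c1 = m\<close>. Just below \<open>m\<close>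
  the rate \<open>R12\<close> is still nonnegative when \<open>g_21 \<noteq> 0\<close>, while user 2 is limited by \<open>R21\<close>, which is
  strictly decreasing when \<open>g_r2 \<noteq> 0\<close>; hence \<open>(0, R21 s)\<close> is lost by requiring \<open>s \<ge> m\<close>.
\<close>

text \<open>An involution exchanging the two users. It turns facts on user 1 into facts on user 2
  and each region, as a relation, into its converse.\<close>

definition swap_users :: "relay_channel \<Rightarrow> relay_channel" where
  "swap_users ch = \<lparr>pow_constr = pow_constr ch, g_12 = g_21 ch, g_1r = g_2r ch, g_21 = g_12 ch,
     g_2r = g_1r ch, g_r1 = g_r2 ch, g_r2 = g_r1 ch\<rparr>"

lemma swap_users_sel [simp]:
  "pow_constr (swap_users ch) = pow_constr ch"
  "g_12 (swap_users ch) = g_21 ch" "g_21 (swap_users ch) = g_12 ch"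
  "g_1r (swap_users ch) = g_2r ch" "g_2r (swap_users ch) = g_1r ch"
  "g_r1 (swap_users ch) = g_r2 ch" "g_r2 (swap_users ch) = g_r1 ch"
  by (simp_all add: swap_users_def)

lemma swap_users_rates [simp]:
  "R11 (swap_users ch) = R21 ch" "R21 (swap_users ch) = R11 ch"
  "R12 (swap_users ch) = R22 ch" "R22 (swap_users ch) = R12 ch"
  by (simp_all add: fun_eq_iff R11_def R21_def R12_def R22_def)

lemma swap_users_thresholds [simp]:
  "sq_sigma_c1 (swap_users ch) = sq_sigma_c2 ch" "sq_sigma_c2 (swap_users ch) = sq_sigma_c1 ch"
  "sq_sigma_e1 (swap_users ch) = sq_sigma_e2 ch" "sq_sigma_e2 (swap_users ch) = sq_sigma_e1 ch"
  by (simp_all add: sq_sigma_c1_def sq_sigma_c2_def sq_sigma_e1_def sq_sigma_e2_def)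

lemma R_NB_swap_users: "R_NB (swap_users ch) = (R_NB ch)\<inverse>"
  by (auto simp: R_NB_def max.commute)

lemma R_NNC_swap_users: "R_NNC (swap_users ch) = (R_NNC ch)\<inverse>"
  by (auto simp: R_NNC_def)

lemma C_nonneg: "0 \<le> x \<Longrightarrow> 0 \<le> C x"
  by (simp add: C_def)

lemma C_le_iff: "0 \<le> x \<Longrightarrow> 0 \<le> y \<Longrightarrow> C x \<le> C y \<longleftrightarrow> x \<le> y"
  by (simp add: C_def)

lemma C_less_iff: "0 \<le> x \<Longrightarrow> 0 \<le> y \<Longrightarrow> C x < C y \<longleftrightarrow> x < y"
  by (simp add: C_def)

text \<open>Merging the two logarithms makes \<open>R12\<close> a single value of \<open>C\<close>,
  comparable with \<open>R11\<close> by arguments alone; the \<open>- 1\<close> cancels the shift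
  inside \<open>C\<close>.\<close>

lemma C_diff:
  assumes "0 \<le> x" "0 < s"
  shows "C x - C (1 / s) = C ((1 + x) * s / (1 + s) - 1)"
proof -
  have "0 < 1 + 1 / s"
    using assms by (simp add: add_pos_pos)
  then have "log 2 (1 + x) - log 2 (1 + 1 / s) = log 2 ((1 + x) / (1 + 1 / s))"
    using assms by (simp add: log_divide)
  also have "(1 + x) / (1 + 1 / s) = (1 + x) * s / (1 + s)"
    using assms by (simp add: field_simps)
  finally show ?thesis
    by (simp add: C_def)
qed

lemma R11_nonneg: "0 \<le> pow_constr ch \<Longrightarrow> 0 < s \<Longrightarrow> 0 \<le> R11 ch s"
  by (simp add: R11_def C_nonneg)

lemma R11_strict_antimono:
  assumes "0 < pow_constr ch" "g_r1 ch \<noteq> 0" "0 < s" "s < t"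
  shows "R11 ch t < R11 ch s"
  using assms by (simp add: R11_def C_less_iff divide_strict_left_mono)

lemma R12_mono:
  assumes "0 < s" "s \<le> t"
  shows "R12 ch s \<le> R12 ch t"
  using assms by (simp add: R12_def C_le_iff frac_le)

text \<open>The product form also covers vanishing gains, where the quotient would be
  \<open>1 / 0\<close>.\<close>

lemma R12_nonneg_iff:
  assumes "0 \<le> pow_constr ch" "0 < s"
  shows "0 \<le> R12 ch s \<longleftrightarrow>
    1 \<le> ((g_21 ch)\<^sup>2 * pow_constr ch + (g_2r ch)\<^sup>2 * pow_constr ch) * s"
  using assms by (simp add: R12_def C_le_iff divide_le_eq)

text \<open>Over the common denominator \<open>1 + s\<close>, the two sides are logarithms of
  \<open>u\<close> and \<open>v\<close>, and \<open>v - u = 1 + a + c - b * s\<close> changes sign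
  exactly at the stated quotient.\<close>

lemma C_diff_le_iff:
  assumes "0 \<le> a" "0 < b" "0 \<le> c" "0 < s"
  shows "C (a + b) - C (1 / s) \<le> C (a + c / (1 + s)) \<longleftrightarrow> s \<le> (1 + a + c) / b"
    and "C (a + c / (1 + s)) \<le> C (a + b) - C (1 / s) \<longleftrightarrow> (1 + a + c) / b \<le> s"
proof -
  define u v where "u = (1 + (a + b)) * s" and "v = (1 + a) * (1 + s) + c"
  have pos: "0 < u / (1 + s)" "0 < v / (1 + s)"
    using assms by (simp_all add: u_def v_def add_pos_nonneg)
  have "C (a + b) - C (1 / s) = C (u / (1 + s) - 1)"
    using assms by (simp add: C_diff u_def)
  moreover have "a + c / (1 + s) = v / (1 + s) - 1"
    using assms by (simp add: v_def field_simps)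
  moreover have "u \<le> v \<longleftrightarrow> s \<le> (1 + a + c) / b" "v \<le> u \<longleftrightarrow> (1 + a + c) / b \<le> s"
    using assms by (simp_all add: u_def v_def pos_le_divide_eq pos_divide_le_eq algebra_simps)
  ultimately show "C (a + b) - C (1 / s) \<le> C (a + c / (1 + s)) \<longleftrightarrow> s \<le> (1 + a + c) / b"
    and "C (a + c / (1 + s)) \<le> C (a + b) - C (1 / s) \<longleftrightarrow> (1 + a + c) / b \<le> s"
    using pos assms by (simp_all add: C_def divide_le_cancel)
qed

lemma
  assumes "0 < pow_constr ch" "g_2r ch \<noteq> 0" "0 < s"
  shows R12_le_R11_iff: "R12 ch s \<le> R11 ch s \<longleftrightarrow> s \<le> sq_sigma_e1 ch"
    and R11_le_R12_iff: "R11 ch s \<le> R12 ch s \<longleftrightarrow> sq_sigma_e1 ch \<le> s"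
  unfolding R11_def R12_def sq_sigma_e1_def
  by (rule C_diff_le_iff; use assms in simp)+

lemma sq_sigma_c1_pos: "0 < pow_constr ch \<Longrightarrow> g_2r ch \<noteq> 0 \<Longrightarrow> 0 < sq_sigma_c1 ch"
  by (simp add: sq_sigma_c1_def add_pos_nonneg)

lemma sq_sigma_c1_le_e1: "0 \<le> pow_constr ch \<Longrightarrow> sq_sigma_c1 ch \<le> sq_sigma_e1 ch"
  by (simp add: sq_sigma_c1_def sq_sigma_e1_def divide_right_mono)

lemmas R21_nonneg = R11_nonneg[of "swap_users ch" for ch, simplified]
  and R21_strict_antimono = R11_strict_antimono[of "swap_users ch" for ch, simplified]
  and R22_mono = R12_mono[of _ _ "swap_users ch" for ch, simplified]
  and R22_le_R21_iff = R12_le_R11_iff[of "swap_users ch" for ch, simplified]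
  and R21_le_R22_iff = R11_le_R12_iff[of "swap_users ch" for ch, simplified]
  and sq_sigma_c2_le_e2 = sq_sigma_c1_le_e1[of "swap_users ch" for ch, simplified]

lemma R_NB_subset_R_NNC:
  assumes "0 < pow_constr ch" "g_2r ch \<noteq> 0"
  shows "R_NB ch \<subseteq> R_NNC ch"
proof -
  have "0 < s" if "max (sq_sigma_c1 ch) (sq_sigma_c2 ch) \<le> s" for s
    using sq_sigma_c1_pos[OF assms] that by linarith
  then show ?thesis
    unfolding R_NB_def R_NNC_def by blast
qed

lemma R_NB_eq_R_NNC:
  assumes "0 < pow_constr ch" "g_1r ch \<noteq> 0" "g_2r ch \<noteq> 0"
    and "sq_sigma_c1 ch \<le> sq_sigma_e2 ch" "sq_sigma_c2 ch \<le> sq_sigma_e1 ch"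
  shows "R_NB ch = R_NNC ch"
proof (rule antisym[OF R_NB_subset_R_NNC[OF assms(1,3)]], rule subrelI)
  fix R1 R2
  assume "(R1, R2) \<in> R_NNC ch"
  then obtain s where s: "0 \<le> R1" "0 \<le> R2" "0 < s" "R1 \<le> R11 ch s" "R1 \<le> R12 ch s"
    "R2 \<le> R21 ch s" "R2 \<le> R22 ch s"
    by (auto simp: R_NNC_def)
  define m where "m = max (sq_sigma_c1 ch) (sq_sigma_c2 ch)"
  \<comment> \<open>For each crossing point, one entry of the maximum is bounded by hypothesis and
    the other unconditionally.\<close>
  have m: "0 < m" "m \<le> sq_sigma_e1 ch" "m \<le> sq_sigma_e2 ch"
    using assms sq_sigma_c1_pos[of ch] sq_sigma_c1_le_e1[of ch] sq_sigma_c2_le_e2[of ch]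
    by (auto simp: m_def)
  show "(R1, R2) \<in> R_NB ch"
  proof (cases "m \<le> s")
    case True
    with s show ?thesis
      by (auto simp: R_NB_def m_def)
  next
    case False
    then have "R12 ch s \<le> R12 ch m" "R22 ch s \<le> R22 ch m"
      using s by (simp_all add: R12_mono R22_mono)
    moreover have "R12 ch m \<le> R11 ch m" "R22 ch m \<le> R21 ch m"
      using assms m by (simp_all add: R12_le_R11_iff R22_le_R21_iff)
    ultimately show ?thesis
      using s by (auto simp: R_NB_def m_def intro!: exI[of _ m])
  qed
qed

lemma R_NB_neq_R_NNC:
  assumes "0 < pow_constr ch" "g_1r ch \<noteq> 0" "g_2r ch \<noteq> 0" "sq_sigma_e2 ch < sq_sigma_c1 ch"
    and "g_21 ch \<noteq> 0" "g_r2 ch \<noteq> 0"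
  shows "R_NB ch \<noteq> R_NNC ch"
proof -
  define a b where "a = (g_21 ch)\<^sup>2 * pow_constr ch" and "b = (g_2r ch)\<^sup>2 * pow_constr ch"
  have pos: "0 < a" "0 < b"
    using assms by (simp_all add: a_def b_def)
  \<comment> \<open>\<open>1 / (a + b)\<close> is the zero of \<open>R12\<close>\<close>
  define s where "s = max (sq_sigma_e2 ch) (1 / (a + b))"
  have zero_le: "1 / (a + b) \<le> s"
    by (simp add: s_def)
  \<comment> \<open>Clearing denominators leaves \<open>b < (1 + a) * (a + b)\<close>. For
    \<open>a = 0\<close> this would be an equality, so \<open>g_21 ch \<noteq> 0\<close> is
    essential here.\<close>
  have "1 / (a + b) < sq_sigma_c1 ch"
    using pos unfolding sq_sigma_c1_def a_def[symmetric] b_def[symmetric]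
    by (simp add: field_simps add_pos_pos)
  then have s: "s < sq_sigma_c1 ch" "sq_sigma_e2 ch \<le> s"
    using assms by (simp_all add: s_def)
  have "0 < 1 / (a + b)"
    using pos by simp
  with zero_le have "0 < s"
    by linarith
  have "0 \<le> R11 ch s" "0 \<le> R21 ch s"
    using assms s \<open>0 < s\<close> by (simp_all add: R11_nonneg R21_nonneg)
  moreover have "0 \<le> R12 ch s"
    using assms zero_le pos \<open>0 < s\<close>
    by (simp add: R12_nonneg_iff pos_divide_le_eq mult.commute[of s] flip: a_def b_def)
  \<comment> \<open>At or beyond the crossing point of user 2, \<open>R21\<close> is the active
    bound, so user 2 attains it in full.\<close>
  moreover have "R21 ch s \<le> R22 ch s"
    using assms s \<open>0 < s\<close> by (simp add: R21_le_R22_iff)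
  ultimately have "(0, R21 ch s) \<in> R_NNC ch"
    using \<open>0 < s\<close> by (auto simp: R_NNC_def)
  moreover have "(0, R21 ch s) \<notin> R_NB ch"
  proof
    assume "(0, R21 ch s) \<in> R_NB ch"
    then obtain t where "sq_sigma_c1 ch \<le> t" "R21 ch s \<le> R21 ch t"
      by (auto simp: R_NB_def)
    with R21_strict_antimono[of ch s t] assms s \<open>0 < s\<close> show False
      by simp
  qed
  ultimately show ?thesis
    by blast
qed

text \<open>Shows that the gain conditions in \<open>nondegenerate\<close> are necessary for strict
  inclusion: without them, raising \<open>s\<close> to the threshold costs neither user
  anything.\<close>

lemma degenerate_imp_R_NB_eq_R_NNC:
  assumes "0 < pow_constr ch" "g_1r ch \<noteq> 0" "g_2r ch \<noteq> 0" "sq_sigma_e2 ch < sq_sigma_c1 ch"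
    and "g_21 ch = 0 \<or> g_r2 ch = 0"
  shows "R_NB ch = R_NNC ch"
proof (rule antisym[OF R_NB_subset_R_NNC[OF assms(1,3)]], rule subrelI)
  fix R1 R2
  assume "(R1, R2) \<in> R_NNC ch"
  then obtain s where s: "0 \<le> R1" "0 \<le> R2" "0 < s" "R1 \<le> R11 ch s" "R1 \<le> R12 ch s"
    "R2 \<le> R21 ch s" "R2 \<le> R22 ch s"
    by (auto simp: R_NNC_def)
  define m where "m = sq_sigma_c1 ch"
  \<comment> \<open>Since \<open>sq_sigma_c2 ch \<le> sq_sigma_e2 ch < sq_sigma_c1 ch\<close>, the
    maximum of the thresholds is \<open>m\<close>.\<close>
  have m: "0 < m" "m \<le> sq_sigma_e1 ch" "sq_sigma_c2 ch \<le> m"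
    using assms sq_sigma_c1_pos[of ch] sq_sigma_c1_le_e1[of ch] sq_sigma_c2_le_e2[of ch]
    by (auto simp: m_def)
  show "(R1, R2) \<in> R_NB ch"
  proof (cases "m \<le> s")
    case True
    with s m show ?thesis
      by (auto simp: R_NB_def m_def)
  next
    case False
    \<comment> \<open>Otherwise \<open>R12\<close> would vanish exactly at \<open>m\<close> and be
      negative at \<open>s < m\<close>, against \<open>0 \<le> R1\<close>.\<close>
    have "g_21 ch \<noteq> 0"
    proof
      assume "g_21 ch = 0"
      moreover have "0 \<le> R12 ch s"
        using s by simp
      ultimately have "m \<le> s"
        using assms s by (simp add: R12_nonneg_iff m_def sq_sigma_c1_def field_simps)
      with False show False by simp
    qed
    then have "R21 ch s = R21 ch m"
      using assms by (simp add: R21_def)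
    moreover have "R12 ch s \<le> R12 ch m" "R22 ch s \<le> R22 ch m"
      using s False by (simp_all add: R12_mono R22_mono)
    moreover have "R12 ch m \<le> R11 ch m"
      using assms m by (simp add: R12_le_R11_iff)
    ultimately show ?thesis
      using s m by (auto simp: R_NB_def m_def intro!: exI[of _ m])
  qed
qed

lemma R_NB_eq_R_NNC_iff:
  assumes "0 < pow_constr ch" "g_1r ch \<noteq> 0" "g_2r ch \<noteq> 0" "sq_sigma_e2 ch < sq_sigma_c1 ch"
  shows "R_NB ch = R_NNC ch \<longleftrightarrow> g_21 ch = 0 \<or> g_r2 ch = 0"
  using R_NB_neq_R_NNC[OF assms] degenerate_imp_R_NB_eq_R_NNC[OF assms] by blast

theorem theorem6:
  fixes ch :: relay_channel
  assumes "pow_constr ch > 0" and "g_1r ch \<noteq> 0" and "g_2r ch \<noteq> 0"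
  shows "(sq_sigma_c1 ch \<le> sq_sigma_e2 ch \<and> sq_sigma_c2 ch \<le> sq_sigma_e1 ch
           \<longrightarrow> R_NB ch = R_NNC ch)
       \<and> (\<not> (sq_sigma_c1 ch \<le> sq_sigma_e2 ch \<and> sq_sigma_c2 ch \<le> sq_sigma_e1 ch)
           \<longrightarrow> R_NB ch \<subseteq> R_NNC ch \<and> (R_NB ch \<subset> R_NNC ch \<longleftrightarrow> nondegenerate ch))"
proof -
  have "R_NB ch = R_NNC ch \<longleftrightarrow> g_12 ch = 0 \<or> g_r1 ch = 0"
    if "sq_sigma_e1 ch < sq_sigma_c2 ch"
    using R_NB_eq_R_NNC_iff[of "swap_users ch"] that assms
    by (simp add: R_NB_swap_users R_NNC_swap_users)
  \<comment> \<open>If both conditions failed, then c1 > e2 >= c2 > e1 >= c1, which is absurd. Hence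
    at most one implication in \<open>nondegenerate\<close> has a true premise.\<close>
  moreover have "sq_sigma_c1 ch \<le> sq_sigma_e1 ch" "sq_sigma_c2 ch \<le> sq_sigma_e2 ch"
    using assms by (simp_all add: sq_sigma_c1_le_e1 sq_sigma_c2_le_e2)
  ultimately show ?thesis
    using R_NB_eq_R_NNC[OF assms] R_NB_eq_R_NNC_iff[OF assms] R_NB_subset_R_NNC[OF assms(1,3)]
    unfolding nondegenerate_def psubset_eq by argo
qed

end
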